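(* Let $(S,\mathcal{S},\hat{\mathcal{S}})$ be a localized Borel space and let $\xi$ be a random signed measure on $S$, defined on a probability space $(\Omega,\mathcal{F},\mathbb{P})$. Then there exist two unique random measures $\xi_+$ and $\xi_-$ on $S$ such that for every $\omega\in\Omega$ and every $B\in\hat{\mathcal{S}}$ $$\xi_+(\omega,B)=\sup_{E\in\mathcal{S},\,E\subset B}\xi(\omega,E),\qquad \xi_-(\omega,B)=\sup_{E\in\mathcal{S},\,E\subset B}-\xi(\omega,E),$$ and $$\xi(\omega,B)=\xi_+(\omega,B)-\xi_-(\omega,B).$$
   Context: A localized Borel space $(S,\mathcal{S},\hat{\mathcal{S}})$ consists of a Borel space $(S,\mathcal{S})$ and a localizing ring $\hat{\mathcal{S}}$, i.e. a ring $\hat{\mathcal{S}}\subset\mathcal{S}$ such that $B\cap C\in\hat{\mathcal{S}}$ for all $B\in\hat{\mathcal{S}}$, $C\in\mathcal{S}$, and $\hat{\mathcal{S}}=\bigcup_n(\mathcal{S}\cap S_n)$ for some sets $S_n\uparrow S$ in $\hat{\mathcal{S}}$, where $\mathcal{S}\cap S_n=\{C\cap S_n:C\in\mathcal{S}\}$. $\mathcal{M}_S$ is the space of locally finite measures on $(S,\mathcal{S})$ (finite on $\hat{\mathcal{S}}$), with the $\sigma$-algebra $\mathcal{B}_{\mathcal{M}_S}$ generated by the maps $\mu\mapsto\mu(B)$, $B\in\mathcal{S}$; a random measure is a measurable map from $(\Omega,\mathcal{F},\mathbb{P})$ to $(\mathcal{M}_S,\mathcal{B}_{\mathcal{M}_S})$.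 $\mathsf{M}_S$ is the space of countably additive set functions $\mu:\hat{\mathcal{S}}\to\mathbb{R}$ ($\mu(\emptyset)=0$ and $\mu(\bigcup_k A_k)=\sum_k\mu(A_k)$, absolutely convergent, for disjoint $A_k\in\hat{\mathcal{S}}$ with union in $\hat{\mathcal{S}}$), with the $\sigma$-algebra $\mathcal{B}_{\mathsf{M}_S}$ generated by $\mu\mapsto\mu(B)$, $B\in\hat{\mathcal{S}}$; a random signed measure is a measurable map from $(\Omega,\mathcal{F},\mathbb{P})$ to $(\mathsf{M}_S,\mathcal{B}_{\mathsf{M}_S})$. We write $\xi(\omega,B)=\xi(\omega)(B)$. *)

theory Defs
  imports "HOL-Probability.Probability"
begin

text \<open>
  A measurable space is represented by a value of type \<^typ>\<open>'a measure\<close> of which only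
  \<^const>\<open>space\<close> and \<^const>\<open>sets\<close> are used.
\<close>

definition borel_isomorphic :: "'a measure \<Rightarrow> 'b measure \<Rightarrow> bool" where
  "borel_isomorphic M N \<longleftrightarrow>
     (\<exists>f g. f \<in> M \<rightarrow>\<^sub>M N \<and> g \<in> N \<rightarrow>\<^sub>M M \<and>
        (\<forall>x\<in>space M. g (f x) = x) \<and> (\<forall>y\<in>space N. f (g y) = y))"

text \<open>Borel space in Kallenberg's sense: isomorphic to a Borel subset of the unit interval.\<close>

definition borel_space :: "'a measure \<Rightarrow> bool" where
  "borel_space M \<longleftrightarrow>
     (\<exists>A\<in>sets (borel :: real measure). A \<subseteq> {0..1} \<and> borel_isomorphic M (restrict_space borel A))"

definition localizing_ring :: "'a measure \<Rightarrow> 'a set set \<Rightarrow> bool" where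
  "localizing_ring M R \<longleftrightarrow>
     ring_of_sets (space M) R \<and> R \<subseteq> sets M \<and>
     (\<forall>B\<in>R. \<forall>C\<in>sets M. B \<inter> C \<in> R) \<and>
     (\<exists>S :: nat \<Rightarrow> 'a set. range S \<subseteq> R \<and> incseq S \<and> (\<Union>n. S n) = space M \<and>
        R = (\<Union>n. {C \<inter> S n |C. C \<in> sets M}))"

definition localized_borel_space :: "'a measure \<Rightarrow> 'a set set \<Rightarrow> bool" where
  "localized_borel_space M R \<longleftrightarrow> borel_space M \<and> localizing_ring M R"

definition locally_finite_measures :: "'a measure \<Rightarrow> 'a set set \<Rightarrow> 'a measure set" where
  "locally_finite_measures M R = {\<mu>. sets \<mu> = sets M \<and> (\<forall>B\<in>R. emeasure \<mu> B < \<infinity>)}"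

definition measure_algebra :: "'a measure \<Rightarrow> 'a set set \<Rightarrow> 'a measure measure" where
  "measure_algebra M R =
     (SUP B\<in>sets M. vimage_algebra (locally_finite_measures M R) (\<lambda>\<mu>. emeasure \<mu> B) borel)"

text \<open>
  Set functions with domain \<open>R\<close> are total functions that are
  \<^const>\<open>undefined\<close> outside \<open>R\<close>.
\<close>

definition local_signed_measures :: "'a set set \<Rightarrow> ('a set \<Rightarrow> real) set" where
  "local_signed_measures R =
     {\<mu> \<in> extensional R. \<mu> {} = 0 \<and>
        (\<forall>A :: nat \<Rightarrow> 'a set. range A \<subseteq> R \<longrightarrow> disjoint_family A \<longrightarrow> (\<Union>k. A k) \<in> R \<longrightarrow>
           summable (\<lambda>k. \<bar>\<mu> (A k)\<bar>) \<and> \<mu> (\<Union>k. A k) = (\<Sum>k. \<mu> (A k)))}"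

definition signed_measure_algebra :: "'a set set \<Rightarrow> ('a set \<Rightarrow> real) measure" where
  "signed_measure_algebra R =
     (SUP B\<in>R. vimage_algebra (local_signed_measures R) (\<lambda>\<mu>. \<mu> B) borel)"

definition random_measure ::
  "'w measure \<Rightarrow> 'a measure \<Rightarrow> 'a set set \<Rightarrow> ('w \<Rightarrow> 'a measure) \<Rightarrow> bool" where
  "random_measure P M R \<xi> \<longleftrightarrow> \<xi> \<in> P \<rightarrow>\<^sub>M measure_algebra M R"

definition random_signed_measure ::
  "'w measure \<Rightarrow> 'a set set \<Rightarrow> ('w \<Rightarrow> 'a set \<Rightarrow> real) \<Rightarrow> bool" where
  "random_signed_measure P R \<xi> \<longleftrightarrow> \<xi> \<in> P \<rightarrow>\<^sub>M signed_measure_algebra R"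

text \<open>
  The suprema are taken in the extended reals, so that no boundedness or sign condition on the
  values of \<open>\<xi>\<close> is built in. The last equation may use the real-valued \<^const>\<open>measure\<close>, since
  random measures are finite on \<open>R\<close>.
\<close>

definition jordan_decomposition ::
  "'w measure \<Rightarrow> 'a measure \<Rightarrow> 'a set set \<Rightarrow> ('w \<Rightarrow> 'a set \<Rightarrow> real) \<Rightarrow>
   ('w \<Rightarrow> 'a measure) \<Rightarrow> ('w \<Rightarrow> 'a measure) \<Rightarrow> bool" where
  "jordan_decomposition P M R \<xi> \<xi>p \<xi>m \<longleftrightarrow>
     (\<forall>\<omega>\<in>space P. \<forall>B\<in>R.
        enn2ereal (emeasure (\<xi>p \<omega>) B) = (SUP E\<in>{E \<in> sets M. E \<subseteq> B}. ereal (\<xi> \<omega> E)) \<and>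
        enn2ereal (emeasure (\<xi>m \<omega>) B) = (SUP E\<in>{E \<in> sets M. E \<subseteq> B}. ereal (- \<xi> \<omega> E)) \<and>
        \<xi> \<omega> B = measure (\<xi>p \<omega>) B - measure (\<xi>m \<omega>) B)"

lemma space_measure_algebra: "space (measure_algebra M R) = locally_finite_measures M R"
  by (auto simp: measure_algebra_def space_Sup_eq_UN)

lemma space_signed_measure_algebra:
  "R \<noteq> {} \<Longrightarrow> space (signed_measure_algebra R) = local_signed_measures R"
  by (auto simp: signed_measure_algebra_def space_Sup_eq_UN)

end

theory Submission
  imports Defs
begin

text \<open>
  For a signed measure \<open>\<mu>\<close> on the ring, put
  \<open>\<nu>(A) = sup {\<mu>(E) | E \<in> R, E \<subseteq> A}\<close> for every measurable \<open>A\<close>. With values in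
  \<open>[0, \<infinity>]\<close> this is a measure without any boundedness assumption. It is finite on the ring: a set
  of infinite variation splits into two pieces that both have \<open>|\<mu>| \<ge> 1\<close>, one of which again has
  infinite variation, so otherwise there would be a disjoint sequence violating absolute
  convergence. Measurability in \<open>\<omega>\<close> holds because the supremum may be restricted to a countable
  family that does not depend on \<open>\<mu>\<close>: transport to the real line and use outer regularity of the
  negative variation together with a countable base of open sets.
\<close>

section \<open>Increasing approximation of open sets by a countable family\<close>

text \<open>A countable base closed under finite unions stays countable, and the partial unions of
  an enumeration increase. Monotone sequences are wanted because a signed measure will be passed to
  the limit along them.\<close>

lemma ex_countable_incseq_open_basis:
  "\<exists>\<G> :: 'a::second_countable_topology set set. countable \<G> \<and> (\<forall>G\<in>\<G>. open G) \<and>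
     (\<forall>U. open U \<longrightarrow> (\<exists>G. range G \<subseteq> \<G> \<and> incseq G \<and> (\<Union>n::nat. G n) = U))"
proof -
  obtain B :: "'a set set" where B: "countable B" "topological_basis B"
    using ex_countable_basis by auto
  define \<G> where "\<G> = Union ` {F. finite F \<and> F \<subseteq> insert {} B}"
  have "countable \<G>"
    unfolding \<G>_def using B by (intro countable_image countable_Collect_finite_subset) auto
  moreover have "open G" if "G \<in> \<G>" for G
  proof -
    have "open b" if "b \<in> insert {} B" for b
      using that topological_basis_open[OF B(2)] by auto
    then show ?thesis using \<open>G \<in> \<G>\<close> unfolding \<G>_def by (blast intro: open_Union)
  qed
  moreover have "\<exists>G. range G \<subseteq> \<G> \<and> incseq G \<and> (\<Union>n::nat. G n) = U" if "open U" for U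
  proof -
    obtain F where F: "F \<subseteq> B" "\<Union>F = U"
      using B(2) \<open>open U\<close> unfolding topological_basis_def by blast
    \<comment> \<open>The extra \<open>{}\<close> makes the enumerated set nonempty even when
      \<open>U\<close> is empty, and it does not change the union.\<close>
    define g where "g = from_nat_into (insert {} F)"
    have g: "range g = insert {} F"
      unfolding g_def using F B by (intro range_from_nat_into) (auto intro: countable_subset)
    define G where "G = (\<lambda>n. \<Union>(g ` {..<n}))"
    have "range G \<subseteq> \<G>"
    proof (rule image_subsetI)
      fix n
      have "g ` {..<n} \<subseteq> insert {} B" using g F by blast
      then show "G n \<in> \<G>" unfolding G_def \<G>_def by (intro imageI) auto
    qed
    moreover have "incseq G"
      unfolding G_def by (intro monoI Union_mono image_mono) auto
    moreover have "(\<Union>n. G n) = \<Union>(range g)"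
      unfolding G_def by auto
    then have "(\<Union>n. G n) = U"
      using g F by simp
    ultimately show ?thesis by blast
  qed
  ultimately show ?thesis by blast
qed

section \<open>Signed measures on a ring and their upper variation\<close>

text \<open>The conditions of \<open>local_signed_measures\<close> without extensionality, which
  negation need not preserve: outside \<open>R\<close> it yields \<open>- undefined\<close>.\<close>

definition signed_on :: "'a set set \<Rightarrow> ('a set \<Rightarrow> real) \<Rightarrow> bool" where
  "signed_on R \<mu> \<longleftrightarrow> \<mu> {} = 0 \<and>
     (\<forall>A :: nat \<Rightarrow> 'a set. range A \<subseteq> R \<longrightarrow> disjoint_family A \<longrightarrow> (\<Union>k. A k) \<in> R \<longrightarrow>
        summable (\<lambda>k. \<bar>\<mu> (A k)\<bar>) \<and> \<mu> (\<Union>k. A k) = (\<Sum>k. \<mu> (A k)))"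

lemma signed_on_uminus:
  assumes "signed_on R \<mu>"
  shows "signed_on R (\<lambda>B. - \<mu> B)"
  using assms unfolding signed_on_def by (auto simp: suminf_minus summable_rabs_cancel)

text \<open>The positive Jordan part; the negative one is the same construction for
  \<open>\<lambda>B. - \<mu> B\<close>. \<open>ennreal\<close> truncates negative values to 0, which
  is harmless since \<open>E = {}\<close> competes with value 0.\<close>

definition upper_variation :: "'a measure \<Rightarrow> 'a set set \<Rightarrow> ('a set \<Rightarrow> real) \<Rightarrow> 'a measure" where
  "upper_variation M R \<mu> =
     measure_of (space M) (sets M) (\<lambda>A. SUP E\<in>{E\<in>R. E \<subseteq> A}. ennreal (\<mu> E))"

lemma sets_upper_variation [simp, measurable_cong]: "sets (upper_variation M R \<mu>) = sets M"
  by (simp add: upper_variation_def)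

lemma space_upper_variation [simp]: "space (upper_variation M R \<mu>) = space M"
  by (simp add: upper_variation_def)

section \<open>Localized spaces: reduction of measurable sets to ring sets\<close>

locale localized_space =
  fixes M :: "'a measure" and R :: "'a set set"
  assumes loc: "localizing_ring M R"
begin

sublocale ring_of_sets "space M" R
  using loc by (simp add: localizing_ring_def)

lemma R_sets: "B \<in> R \<Longrightarrow> B \<in> sets M"
  using loc by (auto simp: localizing_ring_def)

lemma R_subset: "B \<in> R \<Longrightarrow> E \<in> sets M \<Longrightarrow> E \<subseteq> B \<Longrightarrow> E \<in> R"
  using loc by (metis localizing_ring_def inf.absorb2)

lemma R_Int: "B \<in> R \<Longrightarrow> C \<in> sets M \<Longrightarrow> B \<inter> C \<in> R"
  using loc by (auto simp: localizing_ring_def)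

lemma exhaustion:
  obtains S :: "nat \<Rightarrow> 'a set" where "range S \<subseteq> R" "incseq S" "(\<Union>n. S n) = space M"
  using loc by (auto simp: localizing_ring_def)

lemma emeasure_exhaustion:
  assumes "sets \<nu> = sets M" "range S \<subseteq> R" "incseq S" "(\<Union>n. S n) = space M" "A \<in> sets M"
  shows "emeasure \<nu> A = (SUP n. emeasure \<nu> (S n \<inter> A))"
proof -
  have "(SUP n. emeasure \<nu> (S n \<inter> A)) = emeasure \<nu> (\<Union>n. S n \<inter> A)"
    using assms R_sets
    by (intro SUP_emeasure_incseq) (auto intro!: monoI dest: monoD)
  also have "(\<Union>n. S n \<inter> A) = A"
    using assms(4) sets.sets_into_space[OF assms(5)] by auto
  finally show ?thesis by simp
qed

text \<open>Each measurable \<open>A\<close> is the increasing limit of the sets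
  \<open>S n \<inter> A\<close>, which lie in the ring. This gives the uniqueness part of the
  theorem.\<close>

lemma measure_eqI_ring:
  assumes "sets \<nu> = sets M" "sets \<nu>' = sets M" "\<And>B. B \<in> R \<Longrightarrow> emeasure \<nu> B = emeasure \<nu>' B"
  shows "\<nu> = \<nu>'"
proof (rule measure_eqI)
  fix A assume "A \<in> sets \<nu>"
  then have A: "A \<in> sets M" using assms by simp
  obtain S :: "nat \<Rightarrow> 'a set" where S: "range S \<subseteq> R" "incseq S" "(\<Union>n. S n) = space M"
    by (rule exhaustion)
  have "emeasure \<nu> (S n \<inter> A) = emeasure \<nu>' (S n \<inter> A)" for n
    using S(1) by (intro assms(3) R_Int A) auto
  then show "emeasure \<nu> A = emeasure \<nu>' A"
    unfolding emeasure_exhaustion[OF assms(1) S A] emeasure_exhaustion[OF assms(2) S A] by simp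
qed (simp only: assms(1,2))

section \<open>Additivity of the upper variation of a fixed signed measure\<close>

context
  fixes \<mu> :: "'a set \<Rightarrow> real"
  assumes \<mu>: "signed_on R \<mu>"
begin

lemma signed_on_empty: "\<mu> {} = 0"
  using \<mu> by (simp add: signed_on_def)

lemma signed_on_Union:
  fixes A :: "nat \<Rightarrow> 'a set"
  assumes "range A \<subseteq> R" "disjoint_family A" "(\<Union>k. A k) \<in> R"
  shows "summable (\<lambda>k. \<bar>\<mu> (A k)\<bar>)" "\<mu> (\<Union>k. A k) = (\<Sum>k. \<mu> (A k))"
  using \<mu> assms unfolding signed_on_def by auto

lemma signed_on_Un:
  assumes "A \<in> R" "B \<in> R" "A \<inter> B = {}"
  shows "\<mu> (A \<union> B) = \<mu> A + \<mu> B"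
proof -
  have "\<mu> (\<Union>k. binaryset A B k) = (\<Sum>k. \<mu> (binaryset A B k))"
    using assms by (intro signed_on_Union)
      (auto simp: range_binaryset_eq UN_binaryset_eq disjoint_family_on_def binaryset_def)
  then show ?thesis
    by (simp add: UN_binaryset_eq suminf_binaryset_eq signed_on_empty)
qed

lemma signed_on_Diff:
  assumes "A \<in> R" "B \<in> R" "B \<subseteq> A"
  shows "\<mu> (A - B) = \<mu> A - \<mu> B"
proof -
  have "\<mu> (B \<union> (A - B)) = \<mu> B + \<mu> (A - B)"
    using assms by (intro signed_on_Un) auto
  moreover have "B \<union> (A - B) = A" using assms by auto
  ultimately show ?thesis by simp
qed

text \<open>Superadditivity on disjoint sets and monotonicity bound the series from above by the
  value of the union; cutting a competitor \<open>E\<close> along the \<open>A i\<close> gives the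
  converse.\<close>

lemma emeasure_upper_variation:
  assumes "A \<in> sets M"
  shows "emeasure (upper_variation M R \<mu>) A = (SUP E\<in>{E\<in>R. E \<subseteq> A}. ennreal (\<mu> E))"
proof -
  define f where "f A = (SUP E\<in>{E\<in>R. E \<subseteq> A}. ennreal (\<mu> E))" for A
  have f_upper: "ennreal (\<mu> E) \<le> f A" if "E \<in> R" "E \<subseteq> A" for E A
    unfolding f_def using that by (intro SUP_upper) auto
  have f_pair: "f X + f Y \<le> f (X \<union> Y)" if "X \<inter> Y = {}" for X Y
  proof -
    have ne: "{E\<in>R. E \<subseteq> Z} \<noteq> {}" for Z
      by (auto intro: exI[of _ "{}"])
    have "ennreal (\<mu> E) + ennreal (\<mu> F) \<le> f (X \<union> Y)"
      if EF: "E \<in> R" "E \<subseteq> X" "F \<in> R" "F \<subseteq> Y" for E F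
    proof -
      \<comment> \<open>A nonpositive value is truncated to 0, so the other set alone competes for
        the union. Only with two nonnegative values does \<open>ennreal\<close> commute with the
        sum, and then \<open>E \<union> F\<close> competes.\<close>
      consider "\<mu> E \<le> 0" | "\<mu> F \<le> 0" | "\<mu> E \<ge> 0" "\<mu> F \<ge> 0" by linarith
      then show ?thesis
      proof cases
        case 1
        then show ?thesis using f_upper[of F "X \<union> Y"] EF by (auto simp: ennreal_neg)
      next
        case 2
        then show ?thesis using f_upper[of E "X \<union> Y"] EF by (auto simp: ennreal_neg)
      next
        case 3
        have "E \<inter> F = {}" using EF \<open>X \<inter> Y = {}\<close> by auto
        then have "ennreal (\<mu> E) + ennreal (\<mu> F) = ennreal (\<mu> (E \<union> F))"
          using 3 EF by (simp add: signed_on_Un)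
        then show ?thesis using f_upper[of "E \<union> F" "X \<union> Y"] EF by auto
      qed
    qed
    then show ?thesis
      unfolding f_def[of X] f_def[of Y]
      by (subst ennreal_SUP_add_left[OF ne, symmetric], intro SUP_least,
          subst ennreal_SUP_add_right[OF ne], intro SUP_least) auto
  qed
  have pos: "positive (sets M) f"
    unfolding positive_def f_def by (simp add: signed_on_empty)
  have cadd: "countably_additive (sets M) f"
  proof (rule countably_additiveI)
    fix A :: "nat \<Rightarrow> 'a set"
    assume A: "range A \<subseteq> sets M" "disjoint_family A" "(\<Union>i. A i) \<in> sets M"
    have partial: "(\<Sum>i<n. f (A i)) \<le> f (\<Union>i<n. A i)" for n
    proof (induction n)
      case (Suc n)
      have "(\<Union>i<n. A i) \<inter> A n = {}"
        using disjoint_family_onD[OF A(2), of _ n] by (force simp: Int_UN_distrib2)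
      then have "f (\<Union>i<n. A i) + f (A n) \<le> f ((\<Union>i<n. A i) \<union> A n)"
        by (rule f_pair)
      also have "(\<Union>i<n. A i) \<union> A n = (\<Union>i<Suc n. A i)"
        by (auto simp: lessThan_Suc)
      finally show ?case using Suc by (auto intro: order_trans add_right_mono)
    qed simp
    have mono: "f X \<le> f Y" if "X \<subseteq> Y" for X Y
      unfolding f_def using that by (intro SUP_subset_mono) auto
    show "(\<Sum>i. f (A i)) = f (\<Union>i. A i)"
    proof (rule antisym)
      show "(\<Sum>i. f (A i)) \<le> f (\<Union>i. A i)"
        by (intro suminf_le_const summableI order_trans[OF partial] mono) auto
      show "f (\<Union>i. A i) \<le> (\<Sum>i. f (A i))"
        unfolding f_def[of "\<Union>i. A i"]
      proof (rule SUP_least)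
        fix E assume "E \<in> {E \<in> R. E \<subseteq> (\<Union>i. A i)}"
        then have E: "E \<in> R" "(\<Union>i. E \<inter> A i) = E" by auto
        have EA: "E \<inter> A i \<in> R" for i using R_Int[OF E(1)] A(1) by auto
        let ?a = "\<lambda>i. \<mu> (E \<inter> A i)"
        have "range (\<lambda>i. E \<inter> A i) \<subseteq> R" "disjoint_family (\<lambda>i. E \<inter> A i)"
          using EA disjoint_family_onD[OF A(2)] by (auto simp: disjoint_family_on_def)
        then have s: "summable (\<lambda>i. \<bar>?a i\<bar>)" and eq: "\<mu> E = (\<Sum>i. ?a i)"
          using signed_on_Union[of "\<lambda>i. E \<inter> A i"] E by simp_all
        \<comment> \<open>Passing to positive parts, dominated by the absolutely convergent series,
          allows the sum to be moved into \<open>ennreal\<close> term by term.\<close>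
        have s': "summable (\<lambda>i. max 0 (?a i))"
          by (rule summable_comparison_test'[OF s, of 0]) auto
        have "\<mu> E \<le> (\<Sum>i. max 0 (?a i))"
          unfolding eq by (intro suminf_le summable_rabs_cancel[OF s] s') auto
        then have "ennreal (\<mu> E) \<le> (\<Sum>i. ennreal (max 0 (?a i)))"
          using s' by (subst suminf_ennreal2) (auto intro: ennreal_leI)
        also have "\<dots> \<le> (\<Sum>i. f (A i))"
        proof (intro suminf_le summableI)
          fix i
          show "ennreal (max 0 (?a i)) \<le> f (A i)"
            using f_upper[OF EA[of i], of "A i"] by (auto simp: max_def)
        qed
        finally show "ennreal (\<mu> E) \<le> (\<Sum>i. f (A i))" .
      qed
    qed
  qed
  have "emeasure (upper_variation M R \<mu>) A = f A"
  proof (rule emeasure_measure_of)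
    show "upper_variation M R \<mu> = measure_of (space M) (sets M) f"
      by (simp add: upper_variation_def f_def[abs_def])
  qed (use pos cadd assms sets.space_closed in auto)
  then show ?thesis by (simp add: f_def)
qed

lemma upper_variation_upper:
  assumes "E \<in> R" "E \<subseteq> A" "A \<in> sets M"
  shows "ennreal (\<mu> E) \<le> emeasure (upper_variation M R \<mu>) A"
  using assms by (auto simp: emeasure_upper_variation intro: SUP_upper)

section \<open>Local finiteness of the variation\<close>

lemma signed_on_bounded:
  assumes "B \<in> R"
  shows "\<exists>K. \<forall>E\<in>R. E \<subseteq> B \<longrightarrow> \<bar>\<mu> E\<bar> \<le> K"
proof (rule ccontr)
  define unb where "unb = (\<lambda>C. C \<in> R \<and> C \<subseteq> B \<and> (\<forall>K. \<exists>E\<in>R. E \<subseteq> C \<and> K < \<bar>\<mu> E\<bar>))"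
  assume "\<not> ?thesis"
  then have "unb B" using assms by (auto simp: unb_def not_le)
  have unbD: "\<exists>E\<in>R. E \<subseteq> C \<and> K < \<bar>\<mu> E\<bar>" if "unb C" for C K
    using that by (simp add: unb_def)
  have bounded: "\<exists>K. \<forall>F\<in>R. F \<subseteq> D \<longrightarrow> \<bar>\<mu> F\<bar> \<le> K" if "\<not> unb D" "D \<in> R" "D \<subseteq> B" for D
    using that unfolding unb_def by (meson not_less)
  have step: "\<exists>D. unb D \<and> D \<subseteq> C \<and> 1 \<le> \<bar>\<mu> (C - D)\<bar>" if "unb C" for C
  proof -
    have C: "C \<in> R" "C \<subseteq> B" using that by (auto simp: unb_def)
    \<comment> \<open>This threshold forces \<open>\<bar>\<mu> (C - E)\<bar>\<close> above 1 as
      well, so the discarded piece is large whichever of \<open>E\<close> and \<open>C - E\<close>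
      is kept.\<close>
    obtain E where E: "E \<in> R" "E \<subseteq> C" "1 + \<bar>\<mu> C\<bar> < \<bar>\<mu> E\<bar>"
      using unbD[OF \<open>unb C\<close>] by blast
    have diff: "\<mu> (C - E) = \<mu> C - \<mu> E" using C E signed_on_Diff by blast
    have "unb E \<or> unb (C - E)"
    proof (rule ccontr)
      assume "\<not> (unb E \<or> unb (C - E))"
      then have nE: "\<not> unb E" and nCE: "\<not> unb (C - E)" by auto
      have "E \<subseteq> B" "C - E \<in> R" "C - E \<subseteq> B" using C E by auto
      obtain K where K: "\<forall>F\<in>R. F \<subseteq> E \<longrightarrow> \<bar>\<mu> F\<bar> \<le> K"
        using bounded[OF nE E(1) \<open>E \<subseteq> B\<close>] by (rule exE)
      obtain L where L: "\<forall>F\<in>R. F \<subseteq> C - E \<longrightarrow> \<bar>\<mu> F\<bar> \<le> L"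
        using bounded[OF nCE \<open>C - E \<in> R\<close> \<open>C - E \<subseteq> B\<close>] by (rule exE)
      obtain F where F: "F \<in> R" "F \<subseteq> C" "K + L < \<bar>\<mu> F\<bar>"
        using unbD[OF \<open>unb C\<close>] by blast
      have "\<mu> ((F \<inter> E) \<union> (F - E)) = \<mu> (F \<inter> E) + \<mu> (F - E)"
        using F E by (intro signed_on_Un) auto
      moreover have "(F \<inter> E) \<union> (F - E) = F" by auto
      moreover have "\<bar>\<mu> (F \<inter> E)\<bar> \<le> K" using F E by (intro K[rule_format]) auto
      moreover have "\<bar>\<mu> (F - E)\<bar> \<le> L" using F E by (intro L[rule_format]) auto
      ultimately show False using F(3) by simp
    qed
    then show ?thesis
    proof
      assume "unb E"
      moreover have "1 \<le> \<bar>\<mu> (C - E)\<bar>" using diff E by linarith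
      ultimately show ?thesis using E by blast
    next
      assume "unb (C - E)"
      moreover have "C - (C - E) = E" using E by auto
      ultimately show ?thesis using E by (intro exI[of _ "C - E"]) auto
    qed
  qed
  obtain C :: "nat \<Rightarrow> 'a set" where C: "\<And>n. unb (C n)" "\<And>n. C (Suc n) \<subseteq> C n"
    "\<And>n. 1 \<le> \<bar>\<mu> (C n - C (Suc n))\<bar>"
    using dependent_nat_choice[of "\<lambda>_. unb" "\<lambda>_ C D. D \<subseteq> C \<and> 1 \<le> \<bar>\<mu> (C - D)\<bar>"] \<open>unb B\<close> step
    by metis
  have dec: "decseq C" using C(2) by (simp add: decseq_Suc_iff)
  \<comment> \<open>The discarded pieces: disjoint because \<open>C\<close> decreases, with union in
    \<open>R\<close> because they lie in \<open>B\<close>. Their values must tend to 0 by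
    summability, yet all have modulus at least 1.\<close>
  define D where "D = (\<lambda>n. C n - C (Suc n))"
  have D: "D n \<in> R" "D n \<subseteq> B" for n
    using C(1)[of n] C(1)[of "Suc n"] by (auto simp: D_def unb_def)
  have disj: "D m \<inter> D n = {}" if "m < n" for m n
    using decseqD[OF dec, of "Suc m" n] that by (auto simp: D_def)
  have "disjoint_family D"
    unfolding disjoint_family_on_def using disj by (metis inf_commute nat_neq_iff)
  moreover have "(\<Union>n. D n) \<in> R"
    using D R_sets by (intro R_subset[OF assms]) auto
  ultimately have "summable (\<lambda>n. \<bar>\<mu> (D n)\<bar>)"
    using D by (intro signed_on_Union) auto
  then have "(\<lambda>n. \<bar>\<mu> (D n)\<bar>) \<longlonglongrightarrow> 0" by (rule summable_LIMSEQ_zero)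
  then have "1 \<le> (0::real)"
    by (rule LIMSEQ_le_const) (use C(3) in \<open>auto simp: D_def\<close>)
  then show False by simp
qed

lemma upper_variation_finite:
  assumes "B \<in> R"
  shows "emeasure (upper_variation M R \<mu>) B < \<infinity>"
proof -
  obtain K where K: "\<And>E. E \<in> R \<Longrightarrow> E \<subseteq> B \<Longrightarrow> \<bar>\<mu> E\<bar> \<le> K"
    using signed_on_bounded[OF assms] by blast
  have "emeasure (upper_variation M R \<mu>) B \<le> ennreal K"
    unfolding emeasure_upper_variation[OF R_sets[OF assms]]
    by (intro SUP_least ennreal_leI) (use K abs_le_D1 in auto)
  then show ?thesis by (rule le_less_trans) simp
qed

lemma upper_variation_locally_finite:
  "upper_variation M R \<mu> \<in> locally_finite_measures M R"
  using upper_variation_finite by (simp add: locally_finite_measures_def)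

section \<open>The upper variation as a supremum of extended reals and of reals\<close>

lemma upper_variation_SUP_ereal:
  assumes "B \<in> R"
  shows "enn2ereal (emeasure (upper_variation M R \<mu>) B) =
    (SUP E\<in>{E \<in> sets M. E \<subseteq> B}. ereal (\<mu> E))" (is "_ = ?s")
proof (rule antisym)
  \<comment> \<open>Needed for the round trip through \<open>e2ennreal\<close>, which returns
    \<open>?s\<close> only when it is nonnegative.\<close>
  have "0 \<le> ?s"
    by (rule SUP_upper2[of "{}"]) (auto simp: signed_on_empty)
  have "emeasure (upper_variation M R \<mu>) B \<le> e2ennreal ?s"
    unfolding emeasure_upper_variation[OF R_sets[OF assms]]
  proof (rule SUP_least)
    fix E assume "E \<in> {E \<in> R. E \<subseteq> B}"
    then have "ereal (\<mu> E) \<le> ?s" using R_sets by (intro SUP_upper) auto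
    then have "e2ennreal (ereal (\<mu> E)) \<le> e2ennreal ?s" by (rule e2ennreal_mono)
    then show "ennreal (\<mu> E) \<le> e2ennreal ?s" by simp
  qed
  then have "enn2ereal (emeasure (upper_variation M R \<mu>) B) \<le> enn2ereal (e2ennreal ?s)"
    by (simp add: less_eq_ennreal.rep_eq)
  then show "enn2ereal (emeasure (upper_variation M R \<mu>) B) \<le> ?s"
    using \<open>0 \<le> ?s\<close> by (simp add: enn2ereal_e2ennreal)
  show "?s \<le> enn2ereal (emeasure (upper_variation M R \<mu>) B)"
  proof (rule SUP_least)
    fix E assume "E \<in> {E \<in> sets M. E \<subseteq> B}"
    then have "ennreal (\<mu> E) \<le> emeasure (upper_variation M R \<mu>) B"
      using R_subset[OF assms, of E] R_sets[OF assms] by (intro upper_variation_upper) auto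
    then have "enn2ereal (ennreal (\<mu> E)) \<le> enn2ereal (emeasure (upper_variation M R \<mu>) B)"
      by (simp add: less_eq_ennreal.rep_eq)
    moreover have "ereal (\<mu> E) \<le> enn2ereal (ennreal (\<mu> E))"
      by (cases "0 \<le> \<mu> E") (auto simp: enn2ereal_ennreal ennreal_neg zero_ennreal.rep_eq)
    ultimately show "ereal (\<mu> E) \<le> enn2ereal (emeasure (upper_variation M R \<mu>) B)"
      by (rule order_trans[rotated])
  qed
qed

lemma measure_upper_variation_upper:
  assumes "E \<in> R" "E \<subseteq> B" "B \<in> R"
  shows "\<mu> E \<le> measure (upper_variation M R \<mu>) B"
  using upper_variation_upper[OF assms(1,2) R_sets[OF assms(3)]]
    upper_variation_finite[OF assms(3)]
  by (simp add: emeasure_eq_ennreal_measure less_top[symmetric])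

lemma measure_upper_variation_least:
  assumes "B \<in> R" "\<And>E. E \<in> R \<Longrightarrow> E \<subseteq> B \<Longrightarrow> \<mu> E \<le> c"
  shows "measure (upper_variation M R \<mu>) B \<le> c"
proof -
  \<comment> \<open>The empty competitor shows that truncating \<open>c\<close> in
    \<open>ennreal c\<close> loses nothing.\<close>
  have "0 \<le> c" using assms(2)[of "{}"] by (simp add: signed_on_empty)
  have "emeasure (upper_variation M R \<mu>) B \<le> ennreal c"
    unfolding emeasure_upper_variation[OF R_sets[OF assms(1)]]
    using assms(2) by (intro SUP_least ennreal_leI) auto
  then show ?thesis using \<open>0 \<le> c\<close>
    by (simp add: measure_def enn2real_leI)
qed

end

section \<open>The Jordan identity and continuity from below\<close>

text \<open>Complementation in \<open>B\<close> exchanges the two suprema: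
  \<open>\<mu> E = \<mu> B - \<mu> (B - E)\<close>. The resulting inequality, applied to
  \<open>\<mu>\<close> and to its negative, gives both directions.\<close>

lemma jordan_eq:
  assumes \<mu>: "signed_on R \<mu>" and B: "B \<in> R"
  shows "\<mu> B = measure (upper_variation M R \<mu>) B - measure (upper_variation M R (\<lambda>B. - \<mu> B)) B"
proof -
  have *: "measure (upper_variation M R \<mu>) B \<le>
      \<mu> B + measure (upper_variation M R (\<lambda>B. - \<mu> B)) B" if \<mu>: "signed_on R \<mu>" for \<mu>
  proof (rule measure_upper_variation_least[OF \<mu> B])
    fix E assume E: "E \<in> R" "E \<subseteq> B"
    have "- \<mu> (B - E) \<le> measure (upper_variation M R (\<lambda>B. - \<mu> B)) B"
      using E B by (intro measure_upper_variation_upper signed_on_uminus \<mu>) auto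
    then show "\<mu> E \<le> \<mu> B + measure (upper_variation M R (\<lambda>B. - \<mu> B)) B"
      using signed_on_Diff[OF \<mu> B E] by simp
  qed
  from *[OF \<mu>] *[OF signed_on_uminus[OF \<mu>]] show ?thesis by simp
qed

text \<open>Both variations are continuous from below and finite on the union, so their difference,
  which is \<open>\<mu>\<close> on \<open>R\<close>, converges too.\<close>

lemma signed_on_incseq:
  fixes G :: "nat \<Rightarrow> 'a set"
  assumes \<mu>: "signed_on R \<mu>" and G: "range G \<subseteq> R" "incseq G" "(\<Union>n. G n) \<in> R"
  shows "(\<lambda>n. \<mu> (G n)) \<longlonglongrightarrow> \<mu> (\<Union>n. G n)"
proof -
  have "(\<lambda>n. measure (upper_variation M R \<mu>') (G n)) \<longlonglongrightarrow>
      measure (upper_variation M R \<mu>') (\<Union>n. G n)" if "signed_on R \<mu>'" for \<mu>'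
    using G R_sets upper_variation_finite[OF that G(3)] by (intro Lim_measure_incseq) auto
  from tendsto_diff[OF this[OF \<mu>] this[OF signed_on_uminus[OF \<mu>]]] show ?thesis
    using jordan_eq[OF \<mu>] G by (simp add: image_subset_iff)
qed

section \<open>Measurability through a countable supremum\<close>

lemma upper_variation_countable_SUP:
  fixes f :: "'a \<Rightarrow> real" and \<G> :: "real set set"
  assumes \<mu>: "signed_on R \<mu>" and B: "B \<in> R"
    and f: "f \<in> M \<rightarrow>\<^sub>M borel" "\<And>E. E \<in> sets M \<Longrightarrow> \<exists>X\<in>sets borel. E = f -` X \<inter> space M"
    and \<G>: "\<And>G. G \<in> \<G> \<Longrightarrow> open G"
      "\<And>U. open U \<Longrightarrow> \<exists>G. range G \<subseteq> \<G> \<and> incseq G \<and> (\<Union>n::nat. G n) = U"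
  shows "emeasure (upper_variation M R \<mu>) B = (SUP G\<in>\<G>. ennreal (\<mu> (f -` G \<inter> B)))"
    (is "?v = ?s")
proof (rule antisym)
  have BM: "B \<in> sets M" "B \<subseteq> space M" using B R_sets sets.sets_into_space by blast+
  have pre: "f -` X \<inter> B \<in> R" if "X \<in> sets borel" for X
  proof -
    have "B \<inter> (f -` X \<inter> space M) \<in> R"
      using that f(1) by (intro R_Int B) measurable
    moreover have "B \<inter> (f -` X \<inter> space M) = f -` X \<inter> B" using BM by auto
    ultimately show ?thesis by simp
  qed
  show "?s \<le> ?v"
    by (intro SUP_least upper_variation_upper[OF \<mu> _ _ BM(1)] pre) (auto simp: \<G>(1))
  let ?n = "upper_variation M R (\<lambda>B. - \<mu> B)"
  note \<mu>m = signed_on_uminus[OF \<mu>]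
  \<comment> \<open>The image on the line of the negative variation, restricted to \<open>B\<close>
    to make it a finite Borel measure, to which outer regularity applies.\<close>
  define L where "L = distr (restrict_space ?n B) borel f"
  have f': "f \<in> restrict_space ?n B \<rightarrow>\<^sub>M borel"
    using f(1) by (intro measurable_restrict_space1) simp
  have spB: "space (restrict_space ?n B) = B" using BM by (auto simp: space_restrict_space)
  have emL: "emeasure L X = emeasure ?n (f -` X \<inter> B)" if "X \<in> sets borel" for X
    unfolding L_def using that f' BM
    by (simp add: emeasure_distr spB emeasure_restrict_space Int_absorb2)
  have "emeasure L (space L) < \<infinity>"
    using emL[of UNIV] upper_variation_finite[OF \<mu>m B] by (simp add: L_def)
  then have "finite_measure L" by (intro finite_measureI) simp
  then interpret L: finite_measure L .
  show "?v \<le> ?s"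
    unfolding emeasure_upper_variation[OF \<mu> BM(1)]
  proof (rule SUP_least)
    fix E assume "E \<in> {E \<in> R. E \<subseteq> B}"
    then have E: "E \<in> R" "E \<subseteq> B" by auto
    obtain X where X: "X \<in> sets borel" "E = f -` X \<inter> space M"
      using f(2) R_sets[OF E(1)] by blast
    then have EX: "E = f -` X \<inter> B" using E BM by auto
    show "ennreal (\<mu> E) \<le> ?s"
    proof (rule ennreal_le_epsilon)
      fix e :: real assume "0 < e"
      have "emeasure L X = (INF U \<in> {U. X \<subseteq> U \<and> open U}. emeasure L U)"
        by (rule outer_regular) (use X L.emeasure_finite in \<open>auto simp: L_def\<close>)
      moreover have fin: "emeasure L X \<noteq> \<infinity>" by simp
      ultimately have "\<exists>U\<in>{U. X \<subseteq> U \<and> open U}. emeasure L U < emeasure L X + e"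
        by (rule INF_approx_ennreal[OF \<open>0 < e\<close>])
      then obtain U
        where U: "X \<subseteq> U" "open U" "emeasure L U < emeasure L X + e"
        by blast
      have "emeasure L (U - X) = emeasure L U - emeasure L X"
        using U X by (intro emeasure_Diff[OF fin]) (auto simp: L_def)
      also have "\<dots> \<le> e"
        using U(3) by (simp add: ennreal_minus_le_iff less_imp_le)
      finally have "emeasure ?n (f -` (U - X) \<inter> B) \<le> ennreal e"
        using emL[of "U - X"] U X by simp
      then have "measure ?n (f -` (U - X) \<inter> B) \<le> e"
        using \<open>0 < e\<close> by (simp add: measure_def enn2real_leI)
      moreover have UX: "f -` (U - X) \<inter> B \<in> R" using pre[of "U - X"] U X by simp
      from measure_upper_variation_upper[OF \<mu>m UX order_refl UX]
      have "- \<mu> (f -` (U - X) \<inter> B) \<le> measure ?n (f -` (U - X) \<inter> B)" .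
      moreover have "\<mu> (f -` U \<inter> B - E) = \<mu> (f -` U \<inter> B) - \<mu> E"
        using pre[of U] U E EX by (intro signed_on_Diff[OF \<mu>]) auto
      moreover have "f -` U \<inter> B - E = f -` (U - X) \<inter> B" using EX by auto
      \<comment> \<open>The added part is the trace of \<open>U - X\<close>; its negative variation
        is at most \<open>e\<close>, so adding it lowers \<open>\<mu>\<close> by at most
        \<open>e\<close>.\<close>
      ultimately have le: "\<mu> E \<le> \<mu> (f -` U \<inter> B) + e" by simp
      obtain G :: "nat \<Rightarrow> real set" where G: "range G \<subseteq> \<G>" "incseq G" "(\<Union>n. G n) = U"
        using \<G>(2)[OF U(2)] by blast
      have UN: "(\<Union>n. f -` G n \<inter> B) = f -` U \<inter> B" using G by auto
      have "(\<lambda>n. \<mu> (f -` G n \<inter> B)) \<longlonglongrightarrow> \<mu> (\<Union>n. f -` G n \<inter> B)"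
      proof (rule signed_on_incseq[OF \<mu>])
        show "range (\<lambda>n. f -` G n \<inter> B) \<subseteq> R" using G \<G>(1) pre by auto
        show "incseq (\<lambda>n. f -` G n \<inter> B)" using G(2) by (fastforce simp: incseq_def)
        show "(\<Union>n. f -` G n \<inter> B) \<in> R" unfolding UN using pre[of U] U by simp
      qed
      then have "(\<lambda>n. ennreal (\<mu> (f -` G n \<inter> B))) \<longlonglongrightarrow> ennreal (\<mu> (f -` U \<inter> B))"
        unfolding UN by (rule tendsto_ennrealI)
      moreover have "ennreal (\<mu> (f -` G n \<inter> B)) \<le> ?s" for n
        using G(1) by (intro SUP_upper) auto
      ultimately have "ennreal (\<mu> (f -` U \<inter> B)) \<le> ?s"
        by (intro LIMSEQ_le_const2) auto
      \<comment> \<open>The maximum with 0 makes both summands nonnegative, as splitting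
        \<open>ennreal\<close> over the sum requires.\<close>
      have "ennreal (\<mu> E) \<le> ennreal (max 0 (\<mu> (f -` U \<inter> B)) + e)"
        using le by (intro ennreal_leI) simp
      also have "\<dots> = ennreal (\<mu> (f -` U \<inter> B)) + ennreal e"
        using \<open>0 < e\<close> by (subst ennreal_plus) (auto simp: max_def ennreal_neg)
      also have "\<dots> \<le> ?s + ennreal e"
        using \<open>ennreal (\<mu> (f -` U \<inter> B)) \<le> ?s\<close> by (rule add_right_mono)
      finally show "ennreal (\<mu> E) \<le> ?s + ennreal e" .
    qed
  qed
qed

text \<open>Stated for \<open>signed_on\<close> and measurable evaluations, so that it serves both
  \<open>\<xi>\<close> and its negative. Ring sets come from the countable supremum, general
  measurable sets from exhaustion.\<close>

lemma random_measure_upper_variation: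
  assumes "borel_space M"
    and \<xi>: "\<And>\<omega>. \<omega> \<in> space P \<Longrightarrow> signed_on R (\<xi> \<omega>)"
    and meas: "\<And>B. B \<in> R \<Longrightarrow> (\<lambda>\<omega>. \<xi> \<omega> B) \<in> borel_measurable P"
  shows "random_measure P M R (\<lambda>\<omega>. upper_variation M R (\<xi> \<omega>))"
proof -
  obtain A f g where A: "A \<in> sets (borel :: real measure)"
    and f: "f \<in> M \<rightarrow>\<^sub>M restrict_space borel A" and g: "g \<in> restrict_space borel A \<rightarrow>\<^sub>M M"
    and gf: "\<And>x. x \<in> space M \<Longrightarrow> g (f x) = x"
    using assms(1) unfolding borel_space_def borel_isomorphic_def by blast
  have f_borel: "f \<in> M \<rightarrow>\<^sub>M borel"
    using f by (simp add: measurable_restrict_space2_iff)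
  have f_A: "f x \<in> A" if "x \<in> space M" for x
    using measurable_space[OF f that] by (simp add: space_restrict_space)
  \<comment> \<open>The left inverse \<open>g\<close> supplies the Borel set; intersecting with
    \<open>A\<close> stays Borel because \<open>A\<close> is.\<close>
  have f_pull: "\<exists>X\<in>sets borel. E = f -` X \<inter> space M" if "E \<in> sets M" for E
  proof
    show "g -` E \<inter> A \<in> sets borel"
      using measurable_sets[OF g that] A
      by (auto simp: space_restrict_space sets_restrict_space_iff)
    show "E = f -` (g -` E \<inter> A) \<inter> space M"
      using sets.sets_into_space[OF that] gf f_A by auto
  qed
  obtain \<G> :: "real set set" where \<G>: "countable \<G>" "\<And>G. G \<in> \<G> \<Longrightarrow> open G"
    "\<And>U. open U \<Longrightarrow> \<exists>G. range G \<subseteq> \<G> \<and> incseq G \<and> (\<Union>n::nat. G n) = U"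
    using ex_countable_incseq_open_basis by blast
  have ring: "(\<lambda>\<omega>. emeasure (upper_variation M R (\<xi> \<omega>)) B) \<in> borel_measurable P"
    if B: "B \<in> R" for B
  proof -
    have pre: "f -` G \<inter> B \<in> R" if "G \<in> \<G>" for G
    proof -
      have "B \<inter> (f -` G \<inter> space M) \<in> R"
        using \<G>(2)[OF that] f_borel by (intro R_Int B measurable_sets) auto
      moreover have "B \<inter> (f -` G \<inter> space M) = f -` G \<inter> B"
        using sets.sets_into_space[OF R_sets[OF B]] by auto
      ultimately show ?thesis by simp
    qed
    have "(\<lambda>\<omega>. SUP G\<in>\<G>. ennreal (\<xi> \<omega> (f -` G \<inter> B))) \<in> borel_measurable P"
      using \<G>(1) meas[OF pre] by (intro borel_measurable_SUP) auto
    then show ?thesis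
      by (subst measurable_cong[OF upper_variation_countable_SUP[OF \<xi> B f_borel f_pull \<G>(2,3)]])
  qed
  obtain S :: "nat \<Rightarrow> 'a set" where S: "range S \<subseteq> R" "incseq S" "(\<Union>n. S n) = space M"
    by (rule exhaustion)
  have all: "(\<lambda>\<omega>. emeasure (upper_variation M R (\<xi> \<omega>)) C) \<in> borel_measurable P"
    if C: "C \<in> sets M" for C
  proof -
    have "S n \<inter> C \<in> R" for n using S(1) C R_Int by blast
    then have "(\<lambda>\<omega>. SUP n. emeasure (upper_variation M R (\<xi> \<omega>)) (S n \<inter> C)) \<in> borel_measurable P"
      by (intro borel_measurable_SUP ring) auto
    then show ?thesis
      by (subst emeasure_exhaustion[OF _ S C]) auto
  qed
  show ?thesis
    unfolding random_measure_def measure_algebra_def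
    by (rule measurable_Sup2)
      (auto intro!: measurable_vimage_algebra2 all upper_variation_locally_finite \<xi>)
qed

end

section \<open>Existence and uniqueness of the random decomposition\<close>

theorem lemma2p10:
  fixes P :: "'w measure" and M :: "'a measure" and R :: "'a set set"
    and \<xi> :: "'w \<Rightarrow> 'a set \<Rightarrow> real"
  assumes "localized_borel_space M R"
    and "prob_space P"
    and "random_signed_measure P R \<xi>"
  shows "\<exists>\<xi>p \<xi>m. random_measure P M R \<xi>p \<and> random_measure P M R \<xi>m \<and>
           jordan_decomposition P M R \<xi> \<xi>p \<xi>m \<and>
           (\<forall>\<eta>p \<eta>m. random_measure P M R \<eta>p \<and> random_measure P M R \<eta>m \<and>
              jordan_decomposition P M R \<xi> \<eta>p \<eta>m \<longrightarrow>
              (\<forall>\<omega>\<in>space P. \<eta>p \<omega> = \<xi>p \<omega> \<and> \<eta>m \<omega> = \<xi>m \<omega>))"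
proof -
  have borel: "borel_space M" and "localizing_ring M R"
    using assms(1) by (auto simp: localized_borel_space_def)
  then interpret localized_space M R by unfold_locales
  have \<xi>_meas: "\<xi> \<in> P \<rightarrow>\<^sub>M signed_measure_algebra R"
    using assms(3) by (simp add: random_signed_measure_def)
  \<comment> \<open>Ensures that the supremum of sigma-algebras over \<open>R\<close> has the local
    signed measures as its space.\<close>
  have "R \<noteq> {}" using empty_sets by blast
  have \<xi>: "signed_on R (\<xi> \<omega>)" if "\<omega> \<in> space P" for \<omega>
    using measurable_space[OF \<xi>_meas that] space_signed_measure_algebra[OF \<open>R \<noteq> {}\<close>]
    by (auto simp: local_signed_measures_def signed_on_def)
  have eval: "(\<lambda>\<omega>. \<xi> \<omega> B) \<in> borel_measurable P" if "B \<in> R" for B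
  proof -
    have "(\<lambda>\<mu>. \<mu> B) \<in> borel_measurable (signed_measure_algebra R)"
      unfolding signed_measure_algebra_def
      by (rule measurable_Sup1[OF imageI[OF that]])
        (auto intro: measurable_vimage_algebra1)
    from measurable_compose[OF \<xi>_meas this] show ?thesis .
  qed
  define \<xi>p where "\<xi>p = (\<lambda>\<omega>. upper_variation M R (\<xi> \<omega>))"
  define \<xi>m where "\<xi>m = (\<lambda>\<omega>. upper_variation M R (\<lambda>B. - \<xi> \<omega> B))"
  have rp: "random_measure P M R \<xi>p"
    unfolding \<xi>p_def by (intro random_measure_upper_variation borel \<xi> eval)
  have rm: "random_measure P M R \<xi>m"
    unfolding \<xi>m_def
    by (intro random_measure_upper_variation borel signed_on_uminus \<xi> borel_measurable_uminus eval)
  have jd: "jordan_decomposition P M R \<xi> \<xi>p \<xi>m"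
    unfolding jordan_decomposition_def \<xi>p_def \<xi>m_def
    using upper_variation_SUP_ereal[OF \<xi>] upper_variation_SUP_ereal[OF signed_on_uminus[OF \<xi>]]
      jordan_eq[OF \<xi>] by blast
  have unique: "\<eta>p \<omega> = \<xi>p \<omega> \<and> \<eta>m \<omega> = \<xi>m \<omega>"
    if \<eta>: "random_measure P M R \<eta>p" "random_measure P M R \<eta>m"
      "jordan_decomposition P M R \<xi> \<eta>p \<eta>m" and \<omega>: "\<omega> \<in> space P" for \<eta>p \<eta>m \<omega>
  proof -
    \<comment> \<open>Values of a random measure live on the sigma-algebra of \<open>M\<close>, so
      agreement on \<open>R\<close>, forced by the common suprema, implies equality as
      measures.\<close>
    have sets: "sets (\<zeta> \<omega>) = sets M" if "random_measure P M R \<zeta>" for \<zeta>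
      using measurable_space[OF that[unfolded random_measure_def] \<omega>]
      by (simp add: space_measure_algebra locally_finite_measures_def)
    have "enn2ereal (emeasure (\<eta>p \<omega>) B) = enn2ereal (emeasure (\<xi>p \<omega>) B)"
      and "enn2ereal (emeasure (\<eta>m \<omega>) B) = enn2ereal (emeasure (\<xi>m \<omega>) B)" if "B \<in> R" for B
      using \<eta>(3) jd \<omega> that by (simp_all add: jordan_decomposition_def)
    then show ?thesis
      using \<eta>(1,2) rp rm by (simp add: measure_eqI_ring sets enn2ereal_inject)
  qed
  show ?thesis
    using rp rm jd unique by blast
qed

end
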